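(* Let $n\ge 1$ be an integer and suppose that for every $1\le i\le n$ and every integer $s\ge 1$ there exists a complete $s,4i$-useful cycle set. Let $j\ge 1$, let $m_1,m_2,\dots,m_j$ be integers with $1\le m_l\le n$ for all $l$, and let $n_1,n_2,\dots,n_j$ be positive integers. Then every variable snake $n_1C_{4m_1}n_2C_{4m_2}\ldots n_jC_{4m_j}$ is graceful.
   Context: For integers $x<y$ with $x\ge 0$, $[x,y]$ denotes $\{z\in\mathbb{Z} : x\le z\le y\}$. For a graph $G=(V,E)$ with $m$ edges, a map $f:V\to\{0,1,\dots,m\}$ is a graceful labelling if $f$ is injective and the induced edge labelling $g(uv)=|f(u)-f(v)|$ is a bijection from $E$ onto $\{1,2,\dots,m\}$; $G$ is graceful if it has a graceful labelling. Cyclic snake: $kC_r$ denotes any connected graph with exactly $k$ blocks, each block a cycle $C_r$ of length $r$, whose block-cutpoint graph is a path (so the blocks can be listed $B_1,\dots,B_k$ with $B_i$ and $B_{i+1}$ sharing exactly one vertex, which is the $i$-th cut vertex, and the $k-1$ cut vertices are distinct). Variable snake: $n_1C_{r_1}n_2C_{r_2}\ldots n_jC_{r_j}$ denotes any graph obtained from cyclic snakes $n_1C_{r_1},\dots,n_jC_{r_j}$ by identifying, for each $1\le l<j$, a vertex of the last cycle of $n_lC_{r_l}$ with a vertex of the first cycle of $n_{l+1}C_{r_{l+1}}$, where the identified vertices are not already cut vertices (so the resulting graph again has a path as block-cutpoint graph). Useful cycles: let $t$ be even and $s$ a positive integer. (i) For even $d$, an $s,t$-useful cycle with even distance $d$ is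 a cycle of length $t$ whose vertices are given distinct labels from $[0,\frac t2-1]\cup[st-\frac t2,st]$ such that the set of induced edge labels (absolute differences of end labels) is exactly $[st-t+1,st]$, and the vertex labelled $0$ and a vertex labelled $\frac t2-1$ are at distance $d$ in the cycle. (ii) For odd $d$, an $s,t$-odd useful cycle with odd distance $d$ is a cycle of length $t$ whose vertices are given distinct labels from $[0,\frac t2]\cup[st-\frac t2+1,st]$ such that the set of induced edge labels is exactly $[st-t+1,st]$, and the vertex labelled $0$ and a vertex labelled $st-\frac t2+1$ are at distance $d$ in the cycle. A complete $s,t$-useful cycle set is a set of useful cycles of types (i) and (ii), for this $s$ and $t$, whose distances $d$ together form the set $\{1,2,\dots,\frac t2\}$. *)

theory Defs
  imports Main
begin

section \<open>Finite simple graphs\<close>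

record 'a ugraph =
  verts :: "'a set"
  edges :: "'a set set"

definition simple_graph :: "'a ugraph \<Rightarrow> bool" where
  "simple_graph G \<longleftrightarrow> finite (verts G) \<and> (\<forall>e\<in>edges G. e \<subseteq> verts G \<and> card e = 2)"

definition adj :: "'a ugraph \<Rightarrow> ('a \<times> 'a) set" where
  "adj G = {(u, v). {u, v} \<in> edges G}"

definition graph_connected :: "'a ugraph \<Rightarrow> bool" where
  "graph_connected G \<longleftrightarrow> verts G \<noteq> {} \<and> (\<forall>u\<in>verts G. \<forall>v\<in>verts G. (u, v) \<in> (adj G)\<^sup>*)"

text \<open>Only meaningful for vertices joined by a walk.\<close>

definition graph_dist :: "'a ugraph \<Rightarrow> 'a \<Rightarrow> 'a \<Rightarrow> nat" where
  "graph_dist G u v = (LEAST k. (u, v) \<in> adj G ^^ k)"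

definition subgraph :: "'a ugraph \<Rightarrow> 'a ugraph \<Rightarrow> bool" where
  "subgraph H G \<longleftrightarrow> simple_graph H \<and> verts H \<subseteq> verts G \<and> edges H \<subseteq> edges G"

definition graph_union :: "'a ugraph \<Rightarrow> 'a ugraph \<Rightarrow> 'a ugraph" where
  "graph_union G H = \<lparr>verts = verts G \<union> verts H, edges = edges G \<union> edges H\<rparr>"

definition delete_vertex :: "'a ugraph \<Rightarrow> 'a \<Rightarrow> 'a ugraph" where
  "delete_vertex G v = \<lparr>verts = verts G - {v}, edges = {e \<in> edges G. v \<notin> e}\<rparr>"

definition is_path_graph :: "'a list \<Rightarrow> 'a ugraph \<Rightarrow> bool" where
  "is_path_graph xs G \<longleftrightarrow> xs \<noteq> [] \<and> distinct xs \<and> verts G = set xs \<and>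
     edges G = {{xs ! i, xs ! Suc i} | i. Suc i < length xs}"

definition is_cycle_graph :: "nat \<Rightarrow> 'a ugraph \<Rightarrow> bool" where
  "is_cycle_graph r G \<longleftrightarrow> r \<ge> 3 \<and> (\<exists>xs. length xs = r \<and> distinct xs \<and> verts G = set xs \<and>
     edges G = {{xs ! i, xs ! (Suc i mod r)} | i. i < r})"


section \<open>Blocks and the block-cutpoint graph\<close>

text \<open>A cut vertex separates two other vertices lying in the same component.\<close>

definition cut_vertices :: "'a ugraph \<Rightarrow> 'a set" where
  "cut_vertices G = {v \<in> verts G. \<exists>u\<in>verts G - {v}. \<exists>w\<in>verts G - {v}.
     (u, w) \<in> (adj G)\<^sup>* \<and> (u, w) \<notin> (adj (delete_vertex G v))\<^sup>*}"

definition nonseparable :: "'a ugraph \<Rightarrow> bool" where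
  "nonseparable G \<longleftrightarrow> graph_connected G \<and> cut_vertices G = {}"

definition blocks :: "'a ugraph \<Rightarrow> 'a ugraph set" where
  "blocks G = {B. subgraph B G \<and> nonseparable B \<and>
     (\<forall>B'. subgraph B' G \<and> nonseparable B' \<and> subgraph B B' \<longrightarrow> B' = B)}"

definition block_cutpoint_graph :: "'a ugraph \<Rightarrow> ('a ugraph + 'a) ugraph" where
  "block_cutpoint_graph G =
     \<lparr>verts = Inl ` blocks G \<union> Inr ` cut_vertices G,
      edges = {{Inl B, Inr c} | B c. B \<in> blocks G \<and> c \<in> cut_vertices G \<and> c \<in> verts B}\<rparr>"


section \<open>Snakes\<close>

text \<open>
  The list \<open>xs\<close> runs along the block-cutpoint path, from the first block to the last one.
  Both directions of the path are admitted; if \<open>k = 1\<close> then the first and the last block coincide.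
\<close>

definition cyclic_snake :: "nat \<Rightarrow> nat \<Rightarrow> 'a ugraph \<Rightarrow> ('a ugraph + 'a) list \<Rightarrow> bool" where
  "cyclic_snake k r G xs \<longleftrightarrow> simple_graph G \<and> graph_connected G \<and>
     card (blocks G) = k \<and> (\<forall>B\<in>blocks G. is_cycle_graph r B) \<and>
     is_path_graph xs (block_cutpoint_graph G)"

text \<open>
  Identifying a vertex of \<open>G\<close> with a vertex of \<open>S\<close> is expressed as the union of two graphs
  that have exactly one vertex \<open>v\<close> in common.  The last argument is the last cycle, to which
  the next cyclic snake is attached.  That \<open>v\<close> is not a cut vertex of the part \<open>G\<close> built so
  far also excludes the vertex used by the preceding identification.
\<close>

inductive variable_snake_with_last ::
    "(nat \<times> nat) list \<Rightarrow> 'a ugraph \<Rightarrow> 'a ugraph \<Rightarrow> bool" where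
  single: "cyclic_snake k r G xs \<Longrightarrow> last xs = Inl L \<Longrightarrow>
    variable_snake_with_last [(k, r)] G L"
| attach: "variable_snake_with_last ps G L \<Longrightarrow>
    cyclic_snake k r S xs \<Longrightarrow> hd xs = Inl F \<Longrightarrow> last xs = Inl L' \<Longrightarrow>
    verts G \<inter> verts S = {v} \<Longrightarrow> v \<in> verts L \<Longrightarrow> v \<in> verts F \<Longrightarrow>
    v \<notin> cut_vertices G \<Longrightarrow> v \<notin> cut_vertices S \<Longrightarrow>
    variable_snake_with_last (ps @ [(k, r)]) (graph_union G S) L'"

definition variable_snake :: "(nat \<times> nat) list \<Rightarrow> 'a ugraph \<Rightarrow> bool" where
  "variable_snake ps G \<longleftrightarrow> (\<exists>L. variable_snake_with_last ps G L)"


section \<open>Graceful labellings\<close>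

definition edge_label :: "('a \<Rightarrow> int) \<Rightarrow> 'a set \<Rightarrow> int" where
  "edge_label f e = (THE d. \<exists>u v. e = {u, v} \<and> d = \<bar>f u - f v\<bar>)"

lemma edge_label_doubleton: "edge_label f {u, v} = \<bar>f u - f v\<bar>"
  unfolding edge_label_def by (rule the_equality) (auto simp: doubleton_eq_iff)

definition graceful_labelling :: "'a ugraph \<Rightarrow> ('a \<Rightarrow> int) \<Rightarrow> bool" where
  "graceful_labelling G f \<longleftrightarrow> f ` verts G \<subseteq> {0..int (card (edges G))} \<and> inj_on f (verts G) \<and>
     bij_betw (edge_label f) (edges G) {1..int (card (edges G))}"

definition graceful :: "'a ugraph \<Rightarrow> bool" where
  "graceful G \<longleftrightarrow> (\<exists>f. graceful_labelling G f)"


section \<open>Useful cycles\<close>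

definition even_useful_cycle :: "nat \<Rightarrow> nat \<Rightarrow> nat \<Rightarrow> 'a ugraph \<Rightarrow> ('a \<Rightarrow> int) \<Rightarrow> bool" where
  "even_useful_cycle s t d C f \<longleftrightarrow>
     s \<ge> 1 \<and> even t \<and> even d \<and> is_cycle_graph t C \<and> inj_on f (verts C) \<and>
     f ` verts C \<subseteq> {0..int t div 2 - 1} \<union> {int (s * t) - int t div 2..int (s * t)} \<and>
     edge_label f ` edges C = {int (s * t) - int t + 1..int (s * t)} \<and>
     (\<exists>u\<in>verts C. \<exists>v\<in>verts C. f u = 0 \<and> f v = int t div 2 - 1 \<and> graph_dist C u v = d)"

definition odd_useful_cycle :: "nat \<Rightarrow> nat \<Rightarrow> nat \<Rightarrow> 'a ugraph \<Rightarrow> ('a \<Rightarrow> int) \<Rightarrow> bool" where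
  "odd_useful_cycle s t d C f \<longleftrightarrow>
     s \<ge> 1 \<and> even t \<and> odd d \<and> is_cycle_graph t C \<and> inj_on f (verts C) \<and>
     f ` verts C \<subseteq> {0..int t div 2} \<union> {int (s * t) - int t div 2 + 1..int (s * t)} \<and>
     edge_label f ` edges C = {int (s * t) - int t + 1..int (s * t)} \<and>
     (\<exists>u\<in>verts C. \<exists>v\<in>verts C. f u = 0 \<and> f v = int (s * t) - int t div 2 + 1 \<and>
        graph_dist C u v = d)"

definition useful_cycle :: "nat \<Rightarrow> nat \<Rightarrow> nat \<Rightarrow> 'a ugraph \<Rightarrow> ('a \<Rightarrow> int) \<Rightarrow> bool" where
  "useful_cycle s t d C f \<longleftrightarrow> even_useful_cycle s t d C f \<or> odd_useful_cycle s t d C f"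

text \<open>A useful cycle is a pair of a cycle and a labelling of its vertices.\<close>

definition complete_useful_cycle_set ::
    "nat \<Rightarrow> nat \<Rightarrow> ('a ugraph \<times> ('a \<Rightarrow> int)) set \<Rightarrow> bool" where
  "complete_useful_cycle_set s t U \<longleftrightarrow>
     (\<forall>(C, f)\<in>U. \<exists>d. useful_cycle s t d C f) \<and>
     {d. \<exists>(C, f)\<in>U. useful_cycle s t d C f} = {1..t div 2}"

end

theory Submission
  imports Defs
begin

text \<open>
  The labelling is built from the last cycle backwards.  Let \<open>H\<close> be the part of the snake that
  remains after its first cycle \<open>C\<close>, let \<open>w\<close> be the vertex they share, and suppose that \<open>H\<close> has a
  graceful labelling \<open>g\<close> with \<open>g w = 0\<close>.  Let \<open>t\<close> be the length of \<open>C\<close>, \<open>r\<close> the number of edges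
  of \<open>H\<close> and \<open>q = t + r\<close>.  A useful cycle labels \<open>C\<close> with a low and a high group of labels,
  so that the edge labels are \<open>r + 1, \<dots>, q\<close>, a prescribed vertex \<open>v\<close> gets \<open>0\<close>, and \<open>w\<close> gets either
  the top of the low group or the bottom of the high group.  The gap between the two groups
  then has just the width that \<open>H\<close> needs: in the first case add the label of \<open>w\<close> to \<open>g\<close>, in the
  second subtract \<open>g\<close> from it.  The edge labels of \<open>H\<close> do not change, and the union is graceful
  with label \<open>0\<close> at \<open>v\<close>, ready for the next step.  This is \<open>cycle_prolongs\<close>.

  Useful cycles are given for total edge numbers \<open>s t\<close> only, while \<open>q\<close> need not be a multiple of \<open>t\<close>.
  But for \<open>s = 2\<close> every edge label exceeds \<open>t\<close>, so each edge joins a low to a high label; moving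
  the high group by a constant changes all edge labels by that constant, and the
  useful cycles for \<open>s = 2\<close> serve for every \<open>q \<ge> t\<close>.  Where \<open>v\<close> and \<open>w\<close> lie on the cycle enters
  only through their distance, since a cycle has an automorphism carrying any pair of
  vertices to any other pair at the same distance.

  What is left is to see that a snake is a chain of cycles in which only consecutive ones meet,
  in a single vertex.  Every edge lies in a block, and a vertex in two blocks is a cut vertex
  (\<open>common_vertex_of_blocks_is_cut_vertex\<close>), hence adjacent to both blocks in the
  block-cutpoint graph; as that graph is a path, the two blocks are consecutive.
\<close>

section \<open>Graphs, walks and unions\<close>

lemma adj_sym: "(u, v) \<in> adj G \<Longrightarrow> (v, u) \<in> adj G"
  by (simp add: adj_def insert_commute)

lemma reach_sym: "(u, v) \<in> (adj G)\<^sup>* \<Longrightarrow> (v, u) \<in> (adj G)\<^sup>*"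
  by (meson adj_sym symD symI sym_rtrancl)

lemma adj_verts:
  assumes "simple_graph G" "(u, v) \<in> adj G"
  shows "u \<in> verts G" "v \<in> verts G" "u \<noteq> v"
  using assms unfolding simple_graph_def adj_def by fastforce+

lemma adj_mono: "edges H \<subseteq> edges G \<Longrightarrow> adj H \<subseteq> adj G"
  by (auto simp: adj_def)

lemma adj_delete_mono: "edges H \<subseteq> edges G \<Longrightarrow> adj (delete_vertex H y) \<subseteq> adj (delete_vertex G y)"
  by (auto simp: adj_def delete_vertex_def)

lemma adj_delete_subset: "adj (delete_vertex G y) \<subseteq> adj G"
  by (auto simp: adj_def delete_vertex_def)

lemma adj_delete_iff: "(u, v) \<in> adj (delete_vertex G y) \<longleftrightarrow> (u, v) \<in> adj G \<and> u \<noteq> y \<and> v \<noteq> y"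
  by (auto simp: adj_def delete_vertex_def)

lemma finite_edges: "simple_graph G \<Longrightarrow> finite (edges G)"
  unfolding simple_graph_def by (rule finite_subset[of _ "Pow (verts G)"]) auto

lemma simple_edgeE:
  assumes "simple_graph G" "e \<in> edges G"
  obtains u v where "e = {u, v}" "u \<noteq> v" "u \<in> verts G" "v \<in> verts G"
proof -
  have "card e = 2" "e \<subseteq> verts G" using assms by (auto simp: simple_graph_def)
  then show ?thesis using that by (auto simp: card_2_iff)
qed

lemma graph_union_simps [simp]:
  "verts (graph_union G H) = verts G \<union> verts H"
  "edges (graph_union G H) = edges G \<union> edges H"
  by (simp_all add: graph_union_def)

lemma simple_graph_union:
  "simple_graph G \<Longrightarrow> simple_graph H \<Longrightarrow> simple_graph (graph_union G H)"
  by (auto simp: simple_graph_def)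

lemma graph_union_assoc:
  "graph_union (graph_union G H) K = graph_union G (graph_union H K)"
  by (simp add: graph_union_def Un_assoc)

lemma edges_disjoint_if_one_common_vertex:
  assumes "simple_graph G" "simple_graph H" "verts G \<inter> verts H = {w}"
  shows "edges G \<inter> edges H = {}"
proof -
  have False if "e \<in> edges G" "e \<in> edges H" for e
  proof -
    have "card e = 2" "e \<subseteq> verts G \<inter> verts H"
      using that assms(1,2) by (auto simp: simple_graph_def)
    then have "card e \<le> card {w}" using assms(3) by (metis card_mono finite.emptyI finite.insertI)
    with \<open>card e = 2\<close> show False by simp
  qed
  then show ?thesis by blast
qed

section \<open>Graceful labellings with a vertex labelled zero\<close>

definition graceful_from :: "'a ugraph \<Rightarrow> 'a \<Rightarrow> bool" where
  "graceful_from G v \<longleftrightarrow> (\<exists>f. graceful_labelling G f \<and> f v = 0)"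

text \<open>
  Gluing \<open>G\<close> in front of \<open>H\<close> at \<open>w\<close> moves the vertex labelled zero from \<open>w\<close> to \<open>v\<close>.  Since all suitable \<open>H\<close>
  are quantified over, the relation composes along a chain, and no labelling has to be
  tracked once single cycles are known to satisfy it.
\<close>

definition prolongs :: "'a \<Rightarrow> 'a ugraph \<Rightarrow> 'a \<Rightarrow> bool" where
  "prolongs v G w \<longleftrightarrow> simple_graph G \<and> v \<in> verts G \<and> w \<in> verts G \<and> v \<noteq> w \<and>
     (\<forall>H. simple_graph H \<and> verts G \<inter> verts H = {w} \<and> graceful_from H w \<longrightarrow>
        graceful_from (graph_union G H) v)"

lemma prolongs_trans:
  assumes G: "prolongs v G c" and S: "prolongs c S w" and c: "verts G \<inter> verts S = {c}"
  shows "prolongs v (graph_union G S) w"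
  unfolding prolongs_def
proof (intro conjI allI impI)
  have wG: "w \<notin> verts G" using c S by (auto simp: prolongs_def)
  show "simple_graph (graph_union G S)"
    using G S by (simp add: prolongs_def simple_graph_union)
  show "v \<in> verts (graph_union G S)" "w \<in> verts (graph_union G S)"
    using G S by (simp_all add: prolongs_def)
  show "v \<noteq> w" using G wG by (auto simp: prolongs_def)
  fix H assume H: "simple_graph H \<and> verts (graph_union G S) \<inter> verts H = {w} \<and> graceful_from H w"
  have "verts S \<inter> verts H = {w}" using H S by (auto simp: prolongs_def)
  then have "graceful_from (graph_union S H) c" using S H by (simp add: prolongs_def)
  moreover have "verts G \<inter> verts (graph_union S H) = {c}" using H wG c by auto
  moreover have "simple_graph (graph_union S H)"
    using S H by (simp add: prolongs_def simple_graph_union)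
  ultimately show "graceful_from (graph_union (graph_union G S) H) v"
    using G by (simp add: prolongs_def graph_union_assoc)
qed

lemma edge_label_cong:
  assumes "simple_graph G" "e \<in> edges G" "\<And>x. x \<in> verts G \<Longrightarrow> f x = g x"
  shows "edge_label f e = edge_label g e"
proof -
  obtain u v where "e = {u, v}" "u \<in> verts G" "v \<in> verts G" using assms(1,2) by (rule simple_edgeE)
  then show ?thesis by (simp add: edge_label_doubleton assms(3))
qed

lemma edge_label_affine:
  assumes "simple_graph G" "e \<in> edges G"
  shows "edge_label (\<lambda>x. a + f x) e = edge_label f e"
    and "edge_label (\<lambda>x. a - f x) e = edge_label f e"
proof -
  obtain u v where "e = {u, v}" using assms by (rule simple_edgeE)
  then show "edge_label (\<lambda>x. a + f x) e = edge_label f e"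
    and "edge_label (\<lambda>x. a - f x) e = edge_label f e"
    by (simp_all add: edge_label_doubleton)
qed

text \<open>
  Only the images of the edge labels are needed: a map of a finite set onto a set of
  the same size is injective.
\<close>

lemma graceful_labelling_union:
  assumes C: "simple_graph C" and H: "simple_graph H" and w: "verts C \<inter> verts H = {w}"
    and q: "q = int (card (edges C)) + int (card (edges H))"
    and h: "inj_on h (verts C)" "h ` verts C \<subseteq> {0..q}"
      "edge_label h ` edges C = {int (card (edges H)) + 1..q}"
    and g: "inj_on g (verts H)" "g ` verts H \<subseteq> {0..q}"
      "edge_label g ` edges H = {1..int (card (edges H))}"
    and hg: "h w = g w" "h ` verts C \<inter> g ` verts H \<subseteq> {g w}"
  shows "graceful_labelling (graph_union C H) (\<lambda>x. if x \<in> verts C then h x else g x)"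
proof -
  let ?f = "\<lambda>x. if x \<in> verts C then h x else g x"
  have fH: "?f x = g x" if "x \<in> verts H" for x
  proof (cases "x \<in> verts C")
    case True
    then have "x = w" using w that by blast
    then show ?thesis using hg by simp
  qed simp
  have card: "int (card (edges C \<union> edges H)) = q"
    using card_Un_disjoint[OF finite_edges[OF C] finite_edges[OF H]
        edges_disjoint_if_one_common_vertex[OF C H w]] q by simp
  have "edge_label ?f ` edges C = edge_label h ` edges C"
    by (rule image_cong[OF refl]) (rule edge_label_cong[OF C], auto)
  moreover have "edge_label ?f ` edges H = edge_label g ` edges H"
    by (rule image_cong[OF refl]) (rule edge_label_cong[OF H], simp_all only: fH)
  ultimately have im: "edge_label ?f ` (edges C \<union> edges H) = {1..q}"
    using h(3) g(3) q by (auto simp: image_Un)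
  have "inj_on (edge_label ?f) (edges C \<union> edges H)"
    by (rule eq_card_imp_inj_on) (use finite_edges[OF C] finite_edges[OF H] im card in auto)
  then have bij: "bij_betw (edge_label ?f) (edges C \<union> edges H) {1..q}"
    using im by (simp add: bij_betw_def)
  have "?f ` verts C = h ` verts C" "?f ` verts H = g ` verts H"
    using fH by (auto intro!: image_cong)
  then have range: "?f ` (verts C \<union> verts H) \<subseteq> {0..q}"
    using h(2) g(2) by (simp only: image_Un Un_subset_iff)
  have inj: "inj_on ?f (verts C \<union> verts H)"
  proof (rule inj_onI)
    fix x y assume x: "x \<in> verts C \<union> verts H" and y: "y \<in> verts C \<union> verts H" and eq: "?f x = ?f y"
    have mixed: "a = b" if "a \<in> verts C" "b \<in> verts H" "h a = g b" for a b
    proof -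
      have "h a = h w" "g b = g w" using that hg by auto
      then show ?thesis using h(1) g(1) w that by (metis Int_iff inj_onD insertI1)
    qed
    show "x = y"
      using x y eq h(1) g(1) mixed[of x y] mixed[of y x] by (auto split: if_splits dest: inj_onD)
  qed
  show ?thesis unfolding graceful_labelling_def graph_union_simps card
    using bij range inj by blast
qed

section \<open>Cycles and useful cycles\<close>

text \<open>
  Running around the cycle with integer indices makes rotations and reflections of the cycle
  plain substitutions \<open>a + i\<close> and \<open>- i\<close>, with no reduction modulo \<open>n\<close>.
\<close>

definition winding :: "nat \<Rightarrow> (int \<Rightarrow> 'a) \<Rightarrow> 'a ugraph \<Rightarrow> bool" where
  "winding n p C \<longleftrightarrow> n > 0 \<and> (\<forall>i j. p i = p j \<longleftrightarrow> i mod int n = j mod int n) \<and>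
     verts C = range p \<and> edges C = range (\<lambda>i. {p i, p (i + 1)})"

lemma winding_exists:
  assumes "is_cycle_graph n C"
  shows "\<exists>p. winding n p C"
proof -
  obtain xs where n: "n \<ge> 3" and xs: "length xs = n" "distinct xs" "verts C = set xs"
    "edges C = {{xs ! i, xs ! (Suc i mod n)} | i. i < n}"
    using assms by (auto simp: is_cycle_graph_def)
  let ?p = "\<lambda>i. xs ! nat (i mod int n)"
  have lt: "nat (i mod int n) < n" for i using n by (simp add: nat_less_iff)
  have p_nat: "?p (int i) = xs ! i" if "i < n" for i using that by simp
  have p_succ: "?p (i + 1) = xs ! (Suc (nat (i mod int n)) mod n)" for i
  proof -
    have "nat ((i + 1) mod int n) = Suc (nat (i mod int n)) mod n"
      using n by (intro int_int_eq[THEN iffD1]) (simp add: zmod_int mod_simps add.commute)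
    then show ?thesis by simp
  qed
  have "?p i = ?p j \<longleftrightarrow> i mod int n = j mod int n" for i j
  proof -
    have "?p i = ?p j \<longleftrightarrow> nat (i mod int n) = nat (j mod int n)"
      using lt xs(1,2) by (simp add: nth_eq_iff_index_eq)
    also have "\<dots> \<longleftrightarrow> i mod int n = j mod int n" using n by (simp add: eq_nat_nat_iff)
    finally show ?thesis .
  qed
  moreover have "set xs = range ?p"
  proof
    show "set xs \<subseteq> range ?p"
    proof
      fix x assume "x \<in> set xs"
      then obtain i where "i < n" "xs ! i = x" using xs(1) by (auto simp: in_set_conv_nth)
      then have "x = ?p (int i)" using p_nat by simp
      then show "x \<in> range ?p" by (rule range_eqI)
    qed
    show "range ?p \<subseteq> set xs" using lt xs(1) by auto
  qed
  moreover have "edges C = range (\<lambda>i. {?p i, ?p (i + 1)})"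
  proof
    show "edges C \<subseteq> range (\<lambda>i. {?p i, ?p (i + 1)})"
    proof
      fix e assume "e \<in> edges C"
      then obtain i where i: "i < n" "e = {xs ! i, xs ! (Suc i mod n)}" using xs(4) by blast
      then have "e = {?p (int i), ?p (int i + 1)}" using p_succ[of "int i"] by simp
      then show "e \<in> range (\<lambda>i. {?p i, ?p (i + 1)})" by blast
    qed
    show "range (\<lambda>i. {?p i, ?p (i + 1)}) \<subseteq> edges C"
      unfolding xs(4) p_succ using lt by blast
  qed
  ultimately have "winding n ?p C" using n xs(3) unfolding winding_def by auto
  then show ?thesis by blast
qed

lemma range_reindex: "surj g \<Longrightarrow> range (\<lambda>i. f (g i)) = range f"
  by (metis image_image)

lemma winding_shift:
  assumes "winding n p C"
  shows "winding n (\<lambda>i. p (a + i)) C"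
proof -
  have s: "surj (\<lambda>i. a + i)" by (rule surjI[of _ "\<lambda>i. i - a"]) simp
  show ?thesis
    using assms range_reindex[OF s, of p] range_reindex[OF s, of "\<lambda>i. {p i, p (i + 1)}"]
    unfolding winding_def by (simp add: mod_eq_dvd_iff add.assoc)
qed

lemma winding_reflect:
  assumes "winding n p C"
  shows "winding n (\<lambda>i. p (- i)) C"
proof -
  have s: "surj (\<lambda>i::int. - i)" "surj (\<lambda>i::int. - i - 1)"
    by (rule surjI[of _ "\<lambda>i. - i"], simp) (rule surjI[of _ "\<lambda>i. - i - 1"], simp)
  show ?thesis
    using assms range_reindex[OF s(1), of p] range_reindex[OF s(2), of "\<lambda>i. {p i, p (i + 1)}"]
    unfolding winding_def by (simp add: mod_eq_dvd_iff dvd_diff_commute insert_commute)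
qed

text \<open>
  Of the two arcs from \<open>u\<close> to \<open>v\<close> the shorter one is taken, after rotating \<open>u\<close> to index zero
  and reflecting if necessary.
\<close>

lemma winding_between:
  assumes C: "is_cycle_graph n C" and uv: "u \<in> verts C" "v \<in> verts C" "u \<noteq> v"
  obtains p d where "winding n p C" "p 0 = u" "p (int d) = v" "1 \<le> d" "2 * d \<le> n"
proof -
  obtain p where p: "winding n p C" using winding_exists[OF C] by blast
  then obtain a b where ab: "u = p a" "v = p b" using uv by (auto simp: winding_def)
  have n: "int n > 0" using p by (simp add: winding_def)
  define e where "e = (b - a) mod int n"
  have e: "0 \<le> e" "e < int n" using n by (simp_all add: e_def)
  have pe: "p (a + e) = v"
    using p unfolding ab(2) winding_def e_def by (simp add: mod_simps)
  have "e \<noteq> 0" using pe ab uv(3) by auto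
  show ?thesis
  proof (cases "2 * e \<le> int n")
    case True
    show ?thesis
      by (rule that[of "\<lambda>i. p (a + i)" "nat e"])
        (use winding_shift[OF p] ab pe e \<open>e \<noteq> 0\<close> True in auto)
  next
    case False
    have "p (a + - (int n - e)) = p (a + e)"
      using p by (simp add: winding_def mod_eq_dvd_iff)
    then have "p (a + - int (nat (int n - e))) = v" using pe e(2) by simp
    then show ?thesis
      by (intro that[of "\<lambda>i. p (a + - i)" "nat (int n - e)"])
        (use winding_reflect[OF winding_shift[OF p, of a]] ab e False in auto)
  qed
qed

text \<open>
  A walk of \<open>k\<close> edges from index zero ends at an index of absolute value at most \<open>k\<close>, and among
  the integers congruent to \<open>d\<close> none is smaller in absolute value when \<open>2 * d \<le> n\<close>.
\<close>

lemma graph_dist_winding: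
  assumes p: "winding n p C" and d: "2 * d \<le> n"
  shows "graph_dist C (p 0) (p (int d)) = d"
  unfolding graph_dist_def
proof (rule Least_equality)
  have step: "(p i, p (i + 1)) \<in> adj C" for i using p by (auto simp: winding_def adj_def)
  show "(p 0, p (int d)) \<in> adj C ^^ d"
  proof (induction d)
    case (Suc d)
    then show ?case using step[of "int d"] by (auto simp: add.commute)
  qed simp
next
  have inj: "p i = p j \<longleftrightarrow> i mod int n = j mod int n" for i j using p by (simp add: winding_def)
  have walk: "\<exists>i. \<bar>i\<bar> \<le> int k \<and> x = p i" if "(p 0, x) \<in> adj C ^^ k" for k x
    using that
  proof (induction k arbitrary: x)
    case 0
    then show ?case by auto
  next
    case (Suc k)
    then obtain y where "(p 0, y) \<in> adj C ^^ k" "(y, x) \<in> adj C" by auto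
    then obtain i where i: "\<bar>i\<bar> \<le> int k" "y = p i" using Suc.IH by blast
    obtain j where "{p i, x} = {p j, p (j + 1)}"
      using \<open>(y, x) \<in> adj C\<close> i p by (auto simp: winding_def adj_def)
    then consider "p i = p j" "x = p (j + 1)" | "p i = p (j + 1)" "x = p j"
      by (auto simp: doubleton_eq_iff)
    then show ?case
    proof cases
      case 1
      then have "x = p (i + 1)" by (metis inj mod_add_left_eq)
      then show ?thesis using i(1) by (intro exI[of _ "i + 1"]) auto
    next
      case 2
      then have "x = p (i - 1)" by (metis inj mod_diff_left_eq add_diff_cancel_right')
      then show ?thesis using i(1) by (intro exI[of _ "i - 1"]) auto
    qed
  qed
  fix k assume "(p 0, p (int d)) \<in> adj C ^^ k"
  then obtain i where i: "\<bar>i\<bar> \<le> int k" "p (int d) = p i" using walk by blast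
  then have "int n dvd i - int d" by (metis inj mod_eq_dvd_iff)
  then obtain z where z: "i = int d + int n * z" by (metis dvdE add.commute diff_add_cancel)
  show "d \<le> k"
  proof (cases "z \<ge> 0")
    case True
    then have "int n * z \<ge> 0" by simp
    then show ?thesis using i(1) z by linarith
  next
    case False
    then have "int n * (z + 1) \<le> 0" by (simp add: mult_nonneg_nonpos)
    then have "int n * z \<le> - int n" by (simp add: algebra_simps)
    then show ?thesis using i(1) z d by linarith
  qed
qed

lemma is_cycle_graph_simple: "is_cycle_graph n C \<Longrightarrow> simple_graph C"
  unfolding is_cycle_graph_def simple_graph_def
proof (elim conjE exE, intro conjI ballI)
  fix xs e
  assume n: "3 \<le> n" and xs: "length xs = n" "distinct xs" "verts C = set xs"
    "edges C = {{xs ! i, xs ! (Suc i mod n)} | i. i < n}" and e: "e \<in> edges C"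
  obtain i where i: "i < n" "e = {xs ! i, xs ! (Suc i mod n)}" using xs(4) e by blast
  have m: "Suc i mod n < n" using n by simp
  then show "e \<subseteq> verts C" using i xs by auto
  have "Suc i mod n \<noteq> i" using i n by (cases "Suc i = n") auto
  then have "xs ! i \<noteq> xs ! (Suc i mod n)" using i m xs by (simp add: nth_eq_iff_index_eq)
  then show "card e = 2" using i by simp
qed simp

lemma is_cycle_graph_card: "is_cycle_graph n C \<Longrightarrow> card (verts C) = n \<and> card (edges C) \<le> n"
  unfolding is_cycle_graph_def
proof (elim conjE exE, intro conjI)
  fix xs assume xs: "length xs = n" "distinct xs" "verts C = set xs"
    "edges C = {{xs ! i, xs ! (Suc i mod n)} | i. i < n}"
  show "card (verts C) = n" using xs by (simp add: distinct_card)
  have "edges C = (\<lambda>i. {xs ! i, xs ! (Suc i mod n)}) ` {..<n}" using xs(4) by auto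
  then show "card (edges C) \<le> n" using card_image_le[of "{..<n}"] by simp
qed


text \<open>
  The cycle lengths for which the labelling argument works.  For \<open>s = 2\<close> the edge labels start at
  \<open>t + 1\<close>, while two labels of the same group differ by at most \<open>t div 2\<close>; so every edge of the cycle
  joins a low label to a high one.
\<close>

definition admissible :: "nat \<Rightarrow> bool" where
  "admissible t \<longleftrightarrow> even t \<and> t \<ge> 4 \<and>
     (\<exists>U :: (nat ugraph \<times> (nat \<Rightarrow> int)) set. complete_useful_cycle_set 2 t U)"

text \<open>
  A cycle of length \<open>t\<close> labelled for a total of \<open>q\<close> edges has label set \<open>R\<close>, and its exit vertex has
  label \<open>x\<close>.  The two cases are the useful cycles of even and of odd distance; in both, \<open>x\<close> is an end
  of the gap in \<open>R\<close>, which leaves room for the remaining \<open>q - t\<close> edges.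
\<close>

definition exit_range :: "int \<Rightarrow> int \<Rightarrow> int \<Rightarrow> int set \<Rightarrow> bool" where
  "exit_range t q x R \<longleftrightarrow>
     x = t div 2 - 1 \<and> R \<subseteq> {0..t div 2 - 1} \<union> {q - t div 2..q} \<or>
     x = q - t div 2 + 1 \<and> R \<subseteq> {0..t div 2} \<union> {q - t div 2 + 1..q}"

lemma winding_labels_of_useful_cycle:
  assumes t: "admissible t" and d: "1 \<le> d" "2 * d \<le> t"
  obtains a :: "int \<Rightarrow> int" where
    "\<And>i j. a i = a j \<longleftrightarrow> i mod int t = j mod int t" "a 0 = 0"
    "range (\<lambda>i. \<bar>a i - a (i + 1)\<bar>) = {int t + 1..2 * int t}"
    "exit_range (int t) (2 * int t) (a (int d)) (range a)"
proof -
  obtain U :: "(nat ugraph \<times> (nat \<Rightarrow> int)) set"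
    where "complete_useful_cycle_set 2 t U" and t4: "t \<ge> 4" "even t"
    using t by (auto simp: admissible_def)
  moreover have "d \<in> {1..t div 2}" using d by auto
  ultimately have "d \<in> {d. \<exists>(C, f)\<in>U. useful_cycle 2 t d C f}"
    by (simp add: complete_useful_cycle_set_def)
  then obtain C :: "nat ugraph" and f where "useful_cycle 2 t d C f" by auto
  then have C: "is_cycle_graph t C" and f: "inj_on f (verts C)"
    and labels: "edge_label f ` edges C = {int t + 1..2 * int t}"
    and ends: "\<exists>u\<in>verts C. \<exists>v\<in>verts C. f u = 0 \<and> graph_dist C u v = d \<and>
      exit_range (int t) (2 * int t) (f v) (f ` verts C)"
    unfolding useful_cycle_def even_useful_cycle_def odd_useful_cycle_def exit_range_def
    by auto
  obtain u v where uv: "u \<in> verts C" "v \<in> verts C" "f u = 0" "graph_dist C u v = d"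
    "exit_range (int t) (2 * int t) (f v) (f ` verts C)"
    using ends by blast
  have "f v \<noteq> 0" using uv(5) t4 by (auto simp: exit_range_def)
  then have "u \<noteq> v" using uv(3) by auto
  then obtain p e where p: "winding t p C" "p 0 = u" "p (int e) = v" "2 * e \<le> t"
    using winding_between[OF C uv(1,2)] by metis
  have "e = d" using graph_dist_winding[OF p(1,4)] p uv(4) by simp
  have V: "verts C = range p" and E: "edges C = range (\<lambda>i. {p i, p (i + 1)})"
    using p(1) by (auto simp: winding_def)
  have "f (p i) = f (p j) \<longleftrightarrow> i mod int t = j mod int t" for i j
    using inj_on_eq_iff[OF f, of "p i" "p j"] p(1) by (simp add: winding_def)
  moreover have "range (\<lambda>i. \<bar>f (p i) - f (p (i + 1))\<bar>) = {int t + 1..2 * int t}"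
    using labels unfolding E by (simp add: image_image edge_label_doubleton)
  ultimately show ?thesis
    by (intro that[of "\<lambda>i. f (p i)"])
      (use uv p \<open>e = d\<close> in \<open>auto simp: V image_image\<close>)
qed

text \<open>
  Transport the labels of a useful cycle for \<open>s = 2\<close> to \<open>C\<close> by identifying the two windings, and move
  the high labels from below \<open>2 * t\<close> to below \<open>q\<close>.
\<close>

lemma cycle_labelling:
  fixes q :: int
  assumes C: "is_cycle_graph t C" and t: "admissible t" and q: "q \<ge> int t"
    and vw: "v \<in> verts C" "w \<in> verts C" "v \<noteq> w"
  obtains h where "inj_on h (verts C)" "h v = 0" "edge_label h ` edges C = {q - int t + 1..q}"
    "exit_range (int t) q (h w) (h ` verts C)"
proof -
  obtain p d where p: "winding t p C" "p 0 = v" "p (int d) = w" and d: "1 \<le> d" "2 * d \<le> t"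
    using winding_between[OF C vw] by metis
  obtain a where a: "\<And>i j. a i = a j \<longleftrightarrow> i mod int t = j mod int t" "a 0 = 0"
    "range (\<lambda>i. \<bar>a i - a (i + 1)\<bar>) = {int t + 1..2 * int t}"
    "exit_range (int t) (2 * int t) (a (int d)) (range a)"
    by (rule winding_labels_of_useful_cycle[OF t d]) (rule that)
  have t4: "t \<ge> 4" "even t" using t by (auto simp: admissible_def)
  obtain m where m: "t = 2 * m" using t4(2) by (auto elim: evenE)
  have m2: "m \<ge> 2" "int t div 2 = int m" using t4(1) m by auto
  define b where "b i = (if a i \<le> int m then a i else a i + (q - 2 * int t))" for i
  have dich: "0 \<le> a i \<and> a i \<le> int m \<or> 3 * int m \<le> a i \<and> a i \<le> 4 * int m" for i
  proof -
    have "a i \<in> range a" by simp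
    then show ?thesis using a(4) m2 m unfolding exit_range_def by force
  qed
  \<comment> \<open>The high labels may move down by as much as \<open>t = 2 * m\<close>; they still stay above the low ones.\<close>
  have gap: "a j - a i \<ge> 2 * int m + 1" if "a i \<le> int m" "3 * int m \<le> a j" for i j
  proof -
    have "a i \<in> range a" "a j \<in> range a" by simp_all
    then show ?thesis using a(4) m2 m that unfolding exit_range_def by force
  qed
  have bi: "b i = b j \<longleftrightarrow> i mod int t = j mod int t" for i j
    unfolding a(1)[symmetric] b_def using dich[of i] dich[of j] gap[of i j] gap[of j i] q m m2 by auto
  have diff: "\<bar>b i - b (i + 1)\<bar> = \<bar>a i - a (i + 1)\<bar> + (q - 2 * int t)" for i
  proof -
    have "\<bar>a i - a (i + 1)\<bar> \<in> {int t + 1..2 * int t}" using a(3) by blast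
    then show ?thesis
      unfolding b_def using dich[of i] dich[of "i + 1"] q m m2 by auto
  qed
  have V: "verts C = range p" and E: "edges C = range (\<lambda>i. {p i, p (i + 1)})"
    and pi: "\<And>i j. p i = p j \<longleftrightarrow> i mod int t = j mod int t"
    using p(1) by (auto simp: winding_def)
  define h where "h x = b (SOME i. p i = x)" for x
  have h: "h (p i) = b i" for i
  proof -
    have "p (SOME j. p j = p i) = p i" by (rule someI[of _ i]) simp
    then show ?thesis unfolding h_def bi pi .
  qed
  have "edge_label h ` edges C = range (\<lambda>i. \<bar>b i - b (i + 1)\<bar>)"
    unfolding E by (simp add: image_image edge_label_doubleton h)
  also have "\<dots> = (\<lambda>x. x + (q - 2 * int t)) ` range (\<lambda>i. \<bar>a i - a (i + 1)\<bar>)"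
    by (simp add: diff image_image)
  also have "\<dots> = {q - int t + 1..q}" unfolding a(3) by (simp add: add.commute)
  finally have labels: "edge_label h ` edges C = {q - int t + 1..q}" .
  have inj: "inj_on h (verts C)" unfolding V by (auto simp: inj_on_def h bi pi)
  have h0: "h v = 0" using h[of 0] p(2) a(2) by (simp add: b_def)
  have hw: "h w = b (int d)" using h[of "int d"] p(3) by simp
  have hV: "h ` verts C = range b" by (simp add: V image_image h)
  from a(4)[unfolded exit_range_def] have "exit_range (int t) q (b (int d)) (range b)"
  proof (elim disjE conjE)
    assume A: "a (int d) = int t div 2 - 1"
      and R: "range a \<subseteq> {0..int t div 2 - 1} \<union> {2 * int t - int t div 2..2 * int t}"
    have bR: "b i \<in> {0..int t div 2 - 1} \<union> {q - int t div 2..q}" for i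
    proof -
      have "a i \<in> {0..int t div 2 - 1} \<union> {2 * int t - int t div 2..2 * int t}" using R by blast
      then show ?thesis using m m2 by (auto simp: b_def)
    qed
    have "b (int d) = int t div 2 - 1" using A m2 by (simp add: b_def)
    moreover have "range b \<subseteq> {0..int t div 2 - 1} \<union> {q - int t div 2..q}"
      by (rule image_subsetI) (rule bR)
    ultimately show ?thesis by (simp add: exit_range_def)
  next
    assume A: "a (int d) = 2 * int t - int t div 2 + 1"
      and R: "range a \<subseteq> {0..int t div 2} \<union> {2 * int t - int t div 2 + 1..2 * int t}"
    have bR: "b i \<in> {0..int t div 2} \<union> {q - int t div 2 + 1..q}" for i
    proof -
      have "a i \<in> {0..int t div 2} \<union> {2 * int t - int t div 2 + 1..2 * int t}" using R by blast
      then show ?thesis using m m2 by (auto simp: b_def)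
    qed
    have "b (int d) = q - int t div 2 + 1" using A m m2 by (simp add: b_def)
    moreover have "range b \<subseteq> {0..int t div 2} \<union> {q - int t div 2 + 1..q}"
      by (rule image_subsetI) (rule bR)
    ultimately show ?thesis by (simp add: exit_range_def)
  qed
  then show ?thesis using that[OF inj h0 labels] by (simp only: hw hV)
qed

text \<open>
  The rest \<open>H\<close> is labelled inside the gap of the cycle, growing upwards from the label of \<open>w\<close>
  when that is the last low label, downwards when it is the first high one.
\<close>

lemma cycle_prolongs:
  assumes C: "is_cycle_graph t C" and t: "admissible t"
    and vw: "v \<in> verts C" "w \<in> verts C" "v \<noteq> w"
  shows "prolongs v C w"
  unfolding prolongs_def
proof (intro conjI allI impI)
  show sC: "simple_graph C" using C by (rule is_cycle_graph_simple)
  fix H assume "simple_graph H \<and> verts C \<inter> verts H = {w} \<and> graceful_from H w"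
  then obtain g where sH: "simple_graph H" and w: "verts C \<inter> verts H = {w}"
    and g: "graceful_labelling H g" "g w = 0"
    by (auto simp: graceful_from_def)
  define r where "r = int (card (edges H))"
  define q where "q = int t + r"
  have gr: "g ` verts H \<subseteq> {0..r}" "inj_on g (verts H)" "edge_label g ` edges H = {1..r}"
    using g(1) by (auto simp: graceful_labelling_def bij_betw_def r_def)
  have r0: "r \<ge> 0" by (simp add: r_def)
  have tq: "int t \<le> q" by (simp add: q_def r0)
  obtain h where h: "inj_on h (verts C)" "h v = 0" "edge_label h ` edges C = {q - int t + 1..q}"
    and hw: "exit_range (int t) q (h w) (h ` verts C)"
    by (rule cycle_labelling[OF C t tq vw])
  have t4: "t \<ge> 4" "even t" using t by (auto simp: admissible_def)
  obtain m where m: "t = 2 * m" using t4(2) by (auto elim: evenE)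
  have m2: "m \<ge> 2" "int t div 2 = int m" using t4(1) m by auto
  have "card (edge_label h ` edges C) = t" using h(3) by simp
  then have "t \<le> card (edges C)" using card_image_le[OF finite_edges[OF sC]] by metis
  then have cC: "card (edges C) = t" using is_cycle_graph_card[OF C] by simp
  have qc: "q = int (card (edges C)) + int (card (edges H))" by (simp add: q_def r_def cC)
  have hV: "h ` verts C \<subseteq> {0..q}" using hw m m2 r0 by (auto simp: q_def exit_range_def)
  have hl: "edge_label h ` edges C = {int (card (edges H)) + 1..q}"
    using h(3) by (simp add: q_def r_def)
  have "\<exists>g'. inj_on g' (verts H) \<and> g' ` verts H \<subseteq> {0..q} \<and> edge_label g' ` edges H = {1..r} \<and>
    h w = g' w \<and> h ` verts C \<inter> g' ` verts H \<subseteq> {g' w}"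
    using hw[unfolded exit_range_def]
  proof (elim disjE conjE)
    assume A: "h w = int t div 2 - 1" "h ` verts C \<subseteq> {0..int t div 2 - 1} \<union> {q - int t div 2..q}"
    have R: "(\<lambda>x. h w + g x) ` verts H \<subseteq> {h w..h w + r}" using gr(1) by auto
    show ?thesis
    proof (intro exI conjI)
      show "inj_on (\<lambda>x. h w + g x) (verts H)" using gr(2) by (simp add: inj_on_def)
      show "(\<lambda>x. h w + g x) ` verts H \<subseteq> {0..q}"
        using R A(1) m m2 r0 unfolding q_def by force
      show "edge_label (\<lambda>x. h w + g x) ` edges H = {1..r}"
        using gr(3) edge_label_affine(1)[OF sH] by simp
      show "h w = h w + g w" using g(2) by simp
      have "h ` verts C \<inter> {h w..h w + r} \<subseteq> {h w}"
        using A m m2 by (auto simp: q_def)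
      then show "h ` verts C \<inter> (\<lambda>x. h w + g x) ` verts H \<subseteq> {h w + g w}" using R g(2) by auto
    qed
  next
    assume A: "h w = q - int t div 2 + 1" "h ` verts C \<subseteq> {0..int t div 2} \<union> {q - int t div 2 + 1..q}"
    have R: "(\<lambda>x. h w - g x) ` verts H \<subseteq> {h w - r..h w}" using gr(1) by auto
    show ?thesis
    proof (intro exI conjI)
      show "inj_on (\<lambda>x. h w - g x) (verts H)" using gr(2) by (simp add: inj_on_def)
      show "(\<lambda>x. h w - g x) ` verts H \<subseteq> {0..q}"
        using R A(1) m m2 r0 unfolding q_def by force
      show "edge_label (\<lambda>x. h w - g x) ` edges H = {1..r}"
        using gr(3) edge_label_affine(2)[OF sH] by simp
      show "h w = h w - g w" using g(2) by simp
      have "h ` verts C \<inter> {h w - r..h w} \<subseteq> {h w}"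
        using A m m2 by (auto simp: q_def)
      then show "h ` verts C \<inter> (\<lambda>x. h w - g x) ` verts H \<subseteq> {h w - g w}" using R g(2) by auto
    qed
  qed
  then obtain g' where g': "inj_on g' (verts H)" "g' ` verts H \<subseteq> {0..q}"
    "edge_label g' ` edges H = {1..r}" "h w = g' w" "h ` verts C \<inter> g' ` verts H \<subseteq> {g' w}"
    by blast
  have "graceful_labelling (graph_union C H) (\<lambda>x. if x \<in> verts C then h x else g' x)"
    using graceful_labelling_union[OF sC sH w qc h(1) hV hl g'(1,2) _ g'(4,5)] g'(3)
    by (simp add: r_def)
  then show "graceful_from (graph_union C H) v"
    unfolding graceful_from_def using h(2) vw(1) by (intro exI conjI) (assumption, simp)
qed (use vw in auto)

section \<open>Blocks and cut vertices\<close>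

lemma nonseparable_reach_avoiding:
  assumes "nonseparable B" "simple_graph B" "u \<in> verts B - {y}" "w \<in> verts B - {y}"
  shows "(u, w) \<in> (adj (delete_vertex B y))\<^sup>*"
proof -
  have uw: "(u, w) \<in> (adj B)\<^sup>*"
    using assms(1,3,4) by (auto simp: nonseparable_def graph_connected_def)
  show ?thesis
  proof (cases "y \<in> verts B")
    case True
    then show ?thesis using assms uw by (auto simp: nonseparable_def cut_vertices_def)
  next
    case False
    then have "adj B \<subseteq> adj (delete_vertex B y)"
      using adj_verts[OF assms(2)] by (auto simp: adj_delete_iff)
    then show ?thesis using uw rtrancl_mono by blast
  qed
qed

text \<open>
  The edge alone is nonseparable, and a largest nonseparable subgraph containing it is a block.
\<close>

lemma edge_in_some_block:
  assumes G: "simple_graph G" and e: "e \<in> edges G"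
  shows "\<exists>B\<in>blocks G. e \<in> edges B"
proof -
  let ?Q = "\<lambda>B. subgraph B G \<and> nonseparable B \<and> e \<in> edges B"
  let ?size = "\<lambda>B. card (verts B) + card (edges B)"
  obtain u v where uv: "e = {u, v}" "u \<noteq> v" "u \<in> verts G" "v \<in> verts G"
    using G e by (rule simple_edgeE)
  let ?K = "\<lparr>verts = {u, v}, edges = {{u, v}}\<rparr>"
  have "subgraph ?K G" using uv e by (simp add: subgraph_def simple_graph_def)
  moreover have "(u, v) \<in> (adj ?K)\<^sup>*" "(v, u) \<in> (adj ?K)\<^sup>*"
    by (auto intro!: r_into_rtrancl simp: adj_def insert_commute)
  then have "nonseparable ?K"
    by (auto simp: nonseparable_def graph_connected_def cut_vertices_def)
  ultimately have K: "?Q ?K" using uv by simp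
  have "\<forall>B. ?Q B \<longrightarrow> ?size B < Suc (?size G)"
  proof (intro allI impI)
    fix B assume "?Q B"
    then have "verts B \<subseteq> verts G" "edges B \<subseteq> edges G" by (auto simp: subgraph_def)
    then show "?size B < Suc (?size G)"
      using card_mono[of "verts G" "verts B"] card_mono[OF finite_edges[OF G], of "edges B"] G
      by (simp add: simple_graph_def)
  qed
  then obtain B where B: "?Q B" and max: "\<And>B'. ?Q B' \<Longrightarrow> ?size B' \<le> ?size B"
    using ex_has_greatest_nat[of ?Q ?K ?size] K by blast
  have "B' = B" if B': "subgraph B' G" "nonseparable B'" "subgraph B B'" for B'
  proof -
    have sB': "simple_graph B'" using B' by (simp add: subgraph_def)
    have sub: "verts B \<subseteq> verts B'" "edges B \<subseteq> edges B'" using B' by (auto simp: subgraph_def)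
    then have "?Q B'" using B' B by auto
    then have "?size B' \<le> ?size B" by (rule max)
    moreover have fin: "finite (verts B')" "finite (edges B')"
      using sB' finite_edges[OF sB'] by (auto simp: simple_graph_def)
    moreover have "card (verts B) \<le> card (verts B')" "card (edges B) \<le> card (edges B')"
      using sub fin by (simp_all add: card_mono)
    ultimately have "card (verts B) = card (verts B')" "card (edges B) = card (edges B')"
      by linarith+
    then have "verts B = verts B'" "edges B = edges B'"
      using sub fin by (simp_all add: card_subset_eq)
    then show ?thesis by simp
  qed
  then have "B \<in> blocks G" using B by (auto simp: blocks_def)
  then show ?thesis using B by blast
qed

text \<open>
  A shortest walk repeats no vertex, since the part between two visits could be cut out.
\<close>

lemma injective_walk:
  assumes "(u, v) \<in> R\<^sup>*"
  obtains p :: "nat \<Rightarrow> 'a" and n where "p 0 = u" "p n = v" "\<And>i. i < n \<Longrightarrow> (p i, p (Suc i)) \<in> R"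
    "inj_on p {..n}"
proof -
  define n where "n = (LEAST k. (u, v) \<in> R ^^ k)"
  have ex: "\<exists>k. (u, v) \<in> R ^^ k" using assms by (simp add: rtrancl_power)
  then have "(u, v) \<in> R ^^ n" unfolding n_def by (rule LeastI_ex)
  then obtain p where p: "p 0 = u" "p n = v" "\<forall>i<n. (p i, p (Suc i)) \<in> R"
    by (auto simp: relpow_fun_conv)
  have seg: "(p i, p (i + k)) \<in> R ^^ k" if "i + k \<le> n" for i k
    using that
  proof (induction k)
    case (Suc k)
    then show ?case using p(3)[rule_format, of "i + k"] by auto
  qed simp
  have neq: "p i \<noteq> p j" if "i < j" "j \<le> n" for i j
  proof
    assume eq: "p i = p j"
    have "(u, p i) \<in> R ^^ i" using seg[of 0 i] that p(1) by simp
    moreover have "(p i, v) \<in> R ^^ (n - j)" using seg[of j "n - j"] that p(2) eq by simp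
    ultimately have "(u, v) \<in> R ^^ (i + (n - j))" by (auto simp: relpow_add)
    then have "n \<le> i + (n - j)" unfolding n_def by (rule Least_le)
    then show False using that by simp
  qed
  have "inj_on p {..n}"
    by (rule inj_onI) (metis neq atMost_iff linorder_neqE_nat)
  then show ?thesis using that[of p n] p by blast
qed

text \<open>
  Two nonseparable graphs meeting at \<open>x\<close> and joined by a path that avoids \<open>x\<close>.  If a vertex other
  than \<open>x\<close> is deleted, everything still reaches \<open>x\<close>: a vertex of the path can walk to one of its ends,
  as the deleted vertex occurs on one side of it only.  If \<open>x\<close> is deleted, everything reaches the
  start of the path.
\<close>

lemma union_with_ear_nonseparable:
  assumes H: "simple_graph H" and B: "simple_graph B" "nonseparable B"
    and B': "simple_graph B'" "nonseparable B'"
    and x: "x \<in> verts B" "x \<in> verts B'"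
    and b: "p 0 \<in> verts B" "p n \<in> verts B'"
    and inj: "inj_on p {..n}" and px: "\<And>i. i \<le> n \<Longrightarrow> p i \<noteq> x"
    and V: "verts H = verts B \<union> verts B' \<union> p ` {..n}"
    and E: "edges B \<subseteq> edges H" "edges B' \<subseteq> edges H" "\<And>i. i < n \<Longrightarrow> {p i, p (Suc i)} \<in> edges H"
  shows "nonseparable H"
proof -
  let ?R = "\<lambda>y. (adj (delete_vertex H y))\<^sup>*"
  have inB: "(u, w) \<in> ?R y" if "u \<in> verts B - {y}" "w \<in> verts B - {y}" for u w y
    using nonseparable_reach_avoiding[OF B(2,1) that] rtrancl_mono[OF adj_delete_mono[OF E(1)]]
    by blast
  have inB': "(u, w) \<in> ?R y" if "u \<in> verts B' - {y}" "w \<in> verts B' - {y}" for u w y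
    using nonseparable_reach_avoiding[OF B'(2,1) that] rtrancl_mono[OF adj_delete_mono[OF E(2)]]
    by blast
  have seg: "(p i, p (i + k)) \<in> ?R y" if "i + k \<le> n" "\<And>l. i \<le> l \<Longrightarrow> l \<le> i + k \<Longrightarrow> p l \<noteq> y" for i k y
    using that
  proof (induction k)
    case (Suc k)
    have "(p (i + k), p (Suc (i + k))) \<in> adj H"
      using E(3)[of "i + k"] Suc.prems(1) by (simp add: adj_def)
    then have "(p (i + k), p (Suc (i + k))) \<in> adj (delete_vertex H y)"
      using Suc.prems(2) by (simp add: adj_delete_iff)
    moreover have "(p i, p (i + k)) \<in> ?R y" using Suc by auto
    ultimately show ?case by simp
  qed simp
  have avoid: "(u, x) \<in> ?R y" if u: "u \<in> verts H - {y}" and y: "y \<noteq> x" for u y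
  proof -
    consider "u \<in> verts B" | "u \<in> verts B'" | i where "i \<le> n" "u = p i" using u V by auto
    then show ?thesis
    proof cases
      case 1
      then show ?thesis using inB u x y by blast
    next
      case 2
      then show ?thesis using inB' u x y by blast
    next
      case 3
      show ?thesis
      proof (cases "\<forall>j\<le>i. p j \<noteq> y")
        case True
        then have "(p 0, p i) \<in> ?R y" using seg[of 0 i y] 3 by auto
        moreover have "(p 0, x) \<in> ?R y" using True b(1) x(1) y inB[of "p 0" y x] by auto
        ultimately show ?thesis using 3 reach_sym rtrancl_trans by metis
      next
        case False
        then obtain j where j: "j \<le> i" "p j = y" by blast
        have after: "p l \<noteq> y" if "i \<le> l" "l \<le> n" for l
        proof
          assume "p l = y"
          then have "l = j" using inj j that 3 by (auto dest: inj_onD)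
          then show False using j that 3 u by auto
        qed
        then have "(p i, p n) \<in> ?R y" using seg[of i "n - i" y] 3 by auto
        moreover have "(p n, x) \<in> ?R y" using after 3 b(2) x(2) y inB'[of "p n" y x] by auto
        ultimately show ?thesis using 3 by simp
      qed
    qed
  qed
  have to_b: "(u, p 0) \<in> ?R x" if u: "u \<in> verts H - {x}" for u
  proof -
    have path: "(p i, p 0) \<in> ?R x" if "i \<le> n" for i
      using seg[of 0 i x] that px by (auto intro: reach_sym)
    consider "u \<in> verts B" | "u \<in> verts B'" | i where "i \<le> n" "u = p i" using u V by auto
    then show ?thesis
    proof cases
      case 1
      then show ?thesis using inB u b px[of 0] by blast
    next
      case 2
      then have "(u, p n) \<in> ?R x" using inB' u b px[of n] by blast
      then show ?thesis using path[of n] by simp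
    next
      case 3
      then show ?thesis using path by simp
    qed
  qed
  have sub: "?R y \<subseteq> (adj H)\<^sup>*" for y by (rule rtrancl_mono[OF adj_delete_subset])
  have to_x: "(u, x) \<in> (adj H)\<^sup>*" if "u \<in> verts H" for u
  proof (cases "u = x")
    case False
    then have "(u, p 0) \<in> (adj H)\<^sup>*" using to_b sub that by blast
    moreover have "(p 0, x) \<in> (adj B)\<^sup>*"
      using B(2) b x by (auto simp: nonseparable_def graph_connected_def)
    then have "(p 0, x) \<in> (adj H)\<^sup>*" using rtrancl_mono[OF adj_mono[OF E(1)]] by blast
    ultimately show ?thesis by simp
  qed simp
  have conn: "graph_connected H"
    unfolding graph_connected_def using V x to_x by (blast intro: reach_sym rtrancl_trans)
  have "(u, w) \<in> ?R y" if "u \<in> verts H - {y}" "w \<in> verts H - {y}" for u w y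
  proof (cases "y = x")
    case True
    then show ?thesis using to_b that by (blast intro: reach_sym rtrancl_trans)
  next
    case False
    then show ?thesis using avoid that by (blast intro: reach_sym rtrancl_trans)
  qed
  then show ?thesis using conn by (auto simp: nonseparable_def cut_vertices_def)
qed

lemma block_has_another_vertex:
  assumes B: "B \<in> blocks G" and B': "B' \<in> blocks G" and ne: "B \<noteq> B'"
    and x: "x \<in> verts B" "x \<in> verts B'"
  shows "\<exists>b\<in>verts B. b \<noteq> x"
proof (rule ccontr)
  assume "\<not> ?thesis"
  then have V: "verts B = {x}" using x by blast
  have sB: "simple_graph B" using B by (simp add: blocks_def subgraph_def)
  have "edges B = {}"
  proof (rule ccontr)
    assume "edges B \<noteq> {}"
    then obtain e where "e \<in> edges B" by blast
    then show False using sB V by (auto elim: simple_edgeE)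
  qed
  then have "subgraph B B'" using sB V x by (simp add: subgraph_def)
  then have "B' = B" using B B' unfolding blocks_def by blast
  then show False using ne by simp
qed

text \<open>
  If \<open>x\<close> did not separate the two blocks, a path avoiding \<open>x\<close> would join them, and the two blocks
  together with this path would form a nonseparable subgraph, against the maximality of the blocks.
\<close>

lemma common_vertex_of_blocks_is_cut_vertex:
  assumes G: "simple_graph G" "graph_connected G"
    and B: "B \<in> blocks G" and B': "B' \<in> blocks G" and ne: "B \<noteq> B'"
    and x: "x \<in> verts B" "x \<in> verts B'"
  shows "x \<in> cut_vertices G"
proof (rule ccontr)
  assume not_cut: "x \<notin> cut_vertices G"
  have BG: "subgraph B G" "nonseparable B" "subgraph B' G" "nonseparable B'"
    using B B' by (simp_all add: blocks_def)
  then have sB: "simple_graph B" "simple_graph B'"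
    and sub: "verts B \<subseteq> verts G" "verts B' \<subseteq> verts G" "edges B \<subseteq> edges G" "edges B' \<subseteq> edges G"
    by (auto simp: subgraph_def)
  obtain b where b: "b \<in> verts B" "b \<noteq> x" using block_has_another_vertex[OF B B' ne x] by blast
  obtain b' where b': "b' \<in> verts B'" "b' \<noteq> x"
    using block_has_another_vertex[OF B' B ne[symmetric] x(2,1)] by blast
  have bG: "b \<in> verts G" "b' \<in> verts G" using b b' sub by auto
  then have "(b, b') \<in> (adj G)\<^sup>*" using G(2) by (simp add: graph_connected_def)
  then have "(b, b') \<in> (adj (delete_vertex G x))\<^sup>*"
    using not_cut x(1) b b' bG sub(1) by (auto simp: cut_vertices_def)
  then obtain p n where p: "p 0 = b" "p n = b'" "\<And>i. i < n \<Longrightarrow> (p i, p (Suc i)) \<in> adj (delete_vertex G x)"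
    "inj_on p {..n}"
    by (rule injective_walk) (rule that)
  have px: "p i \<noteq> x" if "i \<le> n" for i
  proof (cases "i = n")
    case False
    then show ?thesis using p(3)[of i] that by (simp add: adj_delete_iff)
  qed (use p b' in simp)
  have pG: "p i \<in> verts G" if "i \<le> n" for i
  proof (cases "i = n")
    case False
    then have "(p i, p (Suc i)) \<in> adj G" using p(3)[of i] that by (simp add: adj_delete_iff)
    then show ?thesis using adj_verts[OF G(1)] by blast
  qed (use p b' sub in auto)
  define H where "H = \<lparr>verts = verts B \<union> verts B' \<union> p ` {..n},
    edges = edges B \<union> edges B' \<union> {{p i, p (Suc i)} | i. i < n}\<rparr>"
  have pE: "{p i, p (Suc i)} \<in> edges G \<and> p i \<noteq> p (Suc i)" if "i < n" for i
  proof -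
    have "(p i, p (Suc i)) \<in> adj G" using p(3)[OF that] by (simp add: adj_delete_iff)
    then show ?thesis using adj_verts(3)[OF G(1)] by (simp add: adj_def)
  qed
  have sH: "simple_graph H"
    using sB pE by (auto simp: H_def simple_graph_def)
  have HG: "subgraph H G"
    using sH sub pG pE by (auto simp: H_def subgraph_def)
  have "nonseparable H"
    by (rule union_with_ear_nonseparable[OF sH sB(1) BG(2) sB(2) BG(4) x, of p n])
      (use p b b' px in \<open>auto simp: H_def\<close>)
  moreover have "subgraph B H" "subgraph B' H" using sB by (auto simp: H_def subgraph_def)
  ultimately have "H = B" "H = B'" using B B' HG unfolding blocks_def by blast+
  then show False using ne by simp
qed

section \<open>Snakes as sequences of cycles\<close>

text \<open>
  The points \<open>c i\<close> and \<open>c (Suc i)\<close> are where the chain enters and leaves \<open>B i\<close>.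
\<close>

lemma chain_prolongs:
  assumes "\<And>i. i \<le> n \<Longrightarrow> prolongs (c i) (B i) (c (Suc i))"
    and "\<And>i j. i < j \<Longrightarrow> j \<le> n \<Longrightarrow>
      verts (B i) \<inter> verts (B j) \<subseteq> (if j = Suc i then {c j} else {})"
  shows "prolongs (c 0) \<lparr>verts = (\<Union>i\<le>n. verts (B i)), edges = (\<Union>i\<le>n. edges (B i))\<rparr> (c (Suc n))"
  using assms
proof (induction n)
  case 0
  show ?case using 0(1)[of 0] by (cases "B 0") simp
next
  case (Suc n)
  let ?G = "\<lparr>verts = (\<Union>i\<le>n. verts (B i)), edges = (\<Union>i\<le>n. edges (B i))\<rparr>"
  have IH: "prolongs (c 0) ?G (c (Suc n))"
  proof (rule Suc.IH)
    show "prolongs (c i) (B i) (c (Suc i))" if "i \<le> n" for i using Suc.prems(1) that by simp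
    show "verts (B i) \<inter> verts (B j) \<subseteq> (if j = Suc i then {c j} else {})" if "i < j" "j \<le> n" for i j
      using Suc.prems(2)[of i j] that by simp
  qed
  have last: "prolongs (c (Suc n)) (B (Suc n)) (c (Suc (Suc n)))" by (rule Suc.prems(1)) simp
  have "x = c (Suc n)" if "x \<in> verts ?G" "x \<in> verts (B (Suc n))" for x
  proof -
    from that(1) obtain i where "i \<le> n" "x \<in> verts (B i)" by auto
    then show ?thesis using Suc.prems(2)[of i "Suc n"] that by (auto split: if_splits)
  qed
  moreover have "c (Suc n) \<in> verts ?G" "c (Suc n) \<in> verts (B (Suc n))"
    using IH last by (auto simp: prolongs_def)
  ultimately have "verts ?G \<inter> verts (B (Suc n)) = {c (Suc n)}" by blast
  then have "prolongs (c 0) (graph_union ?G (B (Suc n))) (c (Suc (Suc n)))"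
    by (rule prolongs_trans[OF IH last])
  moreover have "graph_union ?G (B (Suc n)) =
      \<lparr>verts = (\<Union>i\<le>Suc n. verts (B i)), edges = (\<Union>i\<le>Suc n. edges (B i))\<rparr>"
    by (simp add: graph_union_def atMost_Suc Un_commute)
  ultimately show ?case by simp
qed

lemma graph_eq_union_of_blocks:
  assumes G: "simple_graph G" "graph_connected G" and two: "u \<in> verts G" "w \<in> verts G" "u \<noteq> w"
  shows "G = \<lparr>verts = (\<Union>B\<in>blocks G. verts B), edges = (\<Union>B\<in>blocks G. edges B)\<rparr>"
proof -
  have sub: "simple_graph B \<and> verts B \<subseteq> verts G \<and> edges B \<subseteq> edges G" if "B \<in> blocks G" for B
    using that by (simp add: blocks_def subgraph_def)
  have E: "edges G = (\<Union>B\<in>blocks G. edges B)"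
    using edge_in_some_block[OF G(1)] sub by blast
  have "x \<in> (\<Union>B\<in>blocks G. verts B)" if x: "x \<in> verts G" for x
  proof -
    obtain y where y: "y \<in> verts G" "x \<noteq> y" using two by metis
    then have "(x, y) \<in> (adj G)\<^sup>*" using G(2) x by (simp add: graph_connected_def)
    then obtain z where "(x, z) \<in> adj G" using y(2) by (metis converse_rtranclE)
    then have "{x, z} \<in> edges G" by (simp add: adj_def)
    then obtain B where B: "B \<in> blocks G" "{x, z} \<in> edges B" using edge_in_some_block[OF G(1)] by blast
    then have "x \<in> verts B" using sub[OF B(1)] by (auto simp: simple_graph_def)
    then show ?thesis using B(1) by blast
  qed
  then have "verts G = (\<Union>B\<in>blocks G. verts B)" using sub by blast
  then show ?thesis using E by simp
qed

text \<open>
  The blocks of a snake in order, with the cut vertex between \<open>B i\<close> and \<open>B (Suc i)\<close> called \<open>c (Suc i)\<close>;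
  the values \<open>c 0\<close> and \<open>c (Suc n)\<close> are left free for the ends of the chain.
\<close>

definition block_sequence :: "'a ugraph \<Rightarrow> nat \<Rightarrow> (nat \<Rightarrow> 'a ugraph) \<Rightarrow> (nat \<Rightarrow> 'a) \<Rightarrow> bool" where
  "block_sequence S n B c \<longleftrightarrow> B ` {..n} = blocks S \<and>
     (\<forall>i<n. c (Suc i) \<in> verts (B i) \<inter> verts (B (Suc i)) \<inter> cut_vertices S) \<and>
     (\<forall>i. Suc i < n \<longrightarrow> c (Suc i) \<noteq> c (Suc (Suc i))) \<and>
     (\<forall>i j. i < j \<longrightarrow> j \<le> n \<longrightarrow> verts (B i) \<inter> verts (B j) \<subseteq> (if j = Suc i then {c j} else {}))"

lemma path_graph_edge_iff:
  assumes "is_path_graph xs G" "i < length xs" "j < length xs"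
  shows "{xs ! i, xs ! j} \<in> edges G \<longleftrightarrow> j = Suc i \<or> i = Suc j"
proof
  have d: "distinct xs" and E: "edges G = {{xs ! i, xs ! Suc i} | i. Suc i < length xs}"
    using assms(1) by (auto simp: is_path_graph_def)
  show "j = Suc i \<or> i = Suc j" if "{xs ! i, xs ! j} \<in> edges G"
  proof -
    from that obtain l where "{xs ! i, xs ! j} = {xs ! l, xs ! Suc l}" "Suc l < length xs"
      unfolding E mem_Collect_eq by (elim exE conjE)
    then show ?thesis using d assms(2,3) by (auto simp: doubleton_eq_iff nth_eq_iff_index_eq)
  qed
  show "{xs ! i, xs ! j} \<in> edges G" if "j = Suc i \<or> i = Suc j"
    using that
  proof
    assume "j = Suc i"
    then show ?thesis using assms(3) unfolding E by blast
  next
    assume "i = Suc j"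
    then have "{xs ! i, xs ! j} = {xs ! j, xs ! Suc j}" by (simp add: insert_commute)
    then show ?thesis using \<open>i = Suc j\<close> assms(2) unfolding E mem_Collect_eq by metis
  qed
qed

lemma even_sum_imp_double_plus: "even (x + a) \<Longrightarrow> a \<le> x \<Longrightarrow> \<exists>n. x = 2 * n + (a :: nat)"
  by presburger

text \<open>
  Blocks and cut vertices alternate along the path \<open>xs\<close>.  Positions are counted from the first block,
  which comes at index \<open>0\<close> or \<open>1\<close>, so a path beginning with a cut vertex is treated
  along with the others.  The last block is an end of the path and has at most one neighbour there,
  which bounds its cut vertices.
\<close>

lemma cyclic_snake_block_sequence:
  assumes S: "cyclic_snake k r S xs" and L: "last xs = Inl L"
  obtains n B c where "block_sequence S n B c" "B n = L" "\<And>F. hd xs = Inl F \<Longrightarrow> B 0 = F"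
    "\<exists>z. cut_vertices S \<inter> verts L \<subseteq> {z}"
proof -
  let ?P = "block_cutpoint_graph S"
  have path: "is_path_graph xs ?P" and sS: "simple_graph S" "graph_connected S"
    using S by (auto simp: cyclic_snake_def)
  have ne: "xs \<noteq> []" and dist: "distinct xs" and set: "set xs = Inl ` blocks S \<union> Inr ` cut_vertices S"
    using path by (auto simp: is_path_graph_def block_cutpoint_graph_def)
  have edge: "{Inl B, Inr c} \<in> edges ?P \<longleftrightarrow> B \<in> blocks S \<and> c \<in> cut_vertices S \<and> c \<in> verts B" for B c
    by (auto simp: block_cutpoint_graph_def doubleton_eq_iff)
  have alt: "isl (xs ! i) \<noteq> isl (xs ! Suc i)" if "Suc i < length xs" for i
  proof -
    have "{xs ! i, xs ! Suc i} \<in> edges ?P" using path_graph_edge_iff[OF path, of i "Suc i"] that by simp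
    then show ?thesis by (auto simp: block_cutpoint_graph_def doubleton_eq_iff)
  qed
  define a where "a = (if isl (xs ! 0) then 0 else 1 :: nat)"
  have parity: "isl (xs ! i) \<longleftrightarrow> even (i + a)" if "i < length xs" for i
    using that
  proof (induction i)
    case 0
    then show ?case by (simp add: a_def)
  next
    case (Suc i)
    then show ?case using alt[of i] by simp
  qed
  have "isl (xs ! (length xs - 1))" using L ne by (simp add: last_conv_nth)
  then have "even (length xs - 1 + a)" using parity[of "length xs - 1"] ne by simp
  moreover have "a \<le> length xs - 1"
  proof (cases "length xs = 1")
    case True
    then show ?thesis using \<open>isl (xs ! (length xs - 1))\<close> by (simp add: a_def)
  next
    case False
    moreover have "length xs \<noteq> 0" using ne by simp
    ultimately have "1 \<le> length xs - 1" by linarith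
    then show ?thesis by (simp add: a_def)
  qed
  ultimately obtain n where "length xs - 1 = 2 * n + a"
    using even_sum_imp_double_plus by blast
  then have len: "length xs = Suc (2 * n + a)" using ne by (cases xs) auto
  define B where "B i = projl (xs ! (2 * i + a))" for i
  define c where "c i = projr (xs ! (2 * i + a - 1))" for i
  have B: "xs ! (2 * i + a) = Inl (B i)" if "i \<le> n" for i
    unfolding B_def using parity[of "2 * i + a"] that len by simp
  have c: "xs ! Suc (2 * i + a) = Inr (c (Suc i))" if "i < n" for i
    unfolding c_def using parity[of "Suc (2 * i + a)"] that len by (cases "xs ! Suc (2 * i + a)") auto
  have lenB: "2 * i + a < length xs" if "i \<le> n" for i using that len by simp
  have blk: "B i \<in> blocks S" if "i \<le> n" for i
    using B[OF that] set nth_mem[OF lenB[OF that]] by auto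
  have "B ` {..n} = blocks S"
  proof
    show "B ` {..n} \<subseteq> blocks S" using blk by auto
    show "blocks S \<subseteq> B ` {..n}"
    proof
      fix D assume "D \<in> blocks S"
      then have "Inl D \<in> set xs" using set by simp
      then obtain p where p: "p < length xs" "xs ! p = Inl D" by (auto simp: in_set_conv_nth)
      then have "even (p + a)" using parity[of p] by simp
      moreover have "a \<le> p" using \<open>even (p + a)\<close> by (cases p) (auto simp: a_def split: if_splits)
      ultimately obtain i where "p = 2 * i + a"
        using even_sum_imp_double_plus by blast
      then show "D \<in> B ` {..n}" using p B[of i] len by auto
    qed
  qed
  moreover have cut: "c (Suc i) \<in> verts (B i) \<inter> verts (B (Suc i)) \<inter> cut_vertices S" if "i < n" for i
  proof -
    have "{xs ! (2 * i + a), xs ! Suc (2 * i + a)} \<in> edges ?P"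
      using that len by (subst path_graph_edge_iff[OF path]) auto
    moreover have "{xs ! (2 * Suc i + a), xs ! Suc (2 * i + a)} \<in> edges ?P"
      using that len by (subst path_graph_edge_iff[OF path]) auto
    ultimately show ?thesis
      using that by (simp only: B[of i] B[of "Suc i"] c edge Suc_leI less_imp_le) simp
  qed
  moreover have "c (Suc i) \<noteq> c (Suc (Suc i))" if "Suc i < n" for i
  proof
    assume "c (Suc i) = c (Suc (Suc i))"
    then have "xs ! Suc (2 * i + a) = xs ! Suc (2 * Suc i + a)" using c[of i] c[of "Suc i"] that by simp
    then show False using dist that len by (simp add: nth_eq_iff_index_eq)
  qed
  moreover have "verts (B i) \<inter> verts (B j) \<subseteq> (if j = Suc i then {c j} else {})" if ij: "i < j" "j \<le> n" for i j
  proof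
    fix z assume z: "z \<in> verts (B i) \<inter> verts (B j)"
    have "B i \<noteq> B j"
    proof
      assume "B i = B j"
      then have "xs ! (2 * i + a) = xs ! (2 * j + a)" using B[of i] B[of j] ij by simp
      then show False using dist ij len by (simp add: nth_eq_iff_index_eq)
    qed
    then have zc: "z \<in> cut_vertices S"
      using common_vertex_of_blocks_is_cut_vertex[OF sS blk blk, of i j z] ij z by simp
    then have "Inr z \<in> set xs" using set by simp
    then obtain p where p: "p < length xs" "xs ! p = Inr z" by (auto simp: in_set_conv_nth)
    \<comment> \<open>A vertex common to two blocks is a neighbour of both on the path, so it sits between them.\<close>
    have adj: "p = Suc (2 * l + a) \<or> 2 * l + a = Suc p" if "l = i \<or> l = j" for l
    proof -
      have l: "l \<le> n" "z \<in> verts (B l)" using that ij z by auto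
      then have "{xs ! (2 * l + a), xs ! p} \<in> edges ?P"
        by (simp add: B p(2) edge blk zc)
      then show ?thesis using path_graph_edge_iff[OF path lenB[OF l(1)] p(1)] by simp
    qed
    have "j = Suc i" "p = Suc (2 * i + a)" using adj[of i] adj[of j] ij by auto
    then show "z \<in> (if j = Suc i then {c j} else {})" using c[of i] p(2) ij by simp
  qed
  ultimately have seq: "block_sequence S n B c" unfolding block_sequence_def by blast
  have BL: "B n = L" using B[of n] L ne len by (simp add: last_conv_nth)
  have BF: "B 0 = F" if "hd xs = Inl F" for F
    using that ne by (simp add: B_def hd_conv_nth a_def)
  have "cut_vertices S \<inter> verts L \<subseteq> {projr (xs ! (length xs - 2))}"
  proof
    fix z assume z: "z \<in> cut_vertices S \<inter> verts L"
    then have "Inr z \<in> set xs" using set by simp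
    then obtain p where p: "p < length xs" "xs ! p = Inr z" by (auto simp: in_set_conv_nth)
    have "{xs ! (2 * n + a), xs ! p} \<in> edges ?P"
      using z BL blk[of n] by (simp add: B p(2) edge)
    then have "p = Suc (2 * n + a) \<or> 2 * n + a = Suc p"
      using path_graph_edge_iff[OF path lenB[of n] p(1)] by simp
    then have "p = length xs - 2" using p(1) len by auto
    then show "z \<in> {projr (xs ! (length xs - 2))}" using p(2) by simp
  qed
  then show ?thesis using that[OF seq BL] BF by blast
qed

lemma block_sequence_prolongs:
  assumes S: "simple_graph S" "graph_connected S" and seq: "block_sequence S n B c"
    and cyc: "\<forall>C\<in>blocks S. is_cycle_graph t C" and t: "admissible t"
    and v: "v \<in> verts (B 0)" and u: "u \<in> verts (B n)" "u \<notin> cut_vertices S"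
    and vu: "v \<noteq> u" "n > 0 \<Longrightarrow> v \<noteq> c 1"
  shows "prolongs v S u"
proof -
  have im: "B ` {..n} = blocks S"
    and cut: "\<And>i. i < n \<Longrightarrow> c (Suc i) \<in> verts (B i) \<inter> verts (B (Suc i)) \<inter> cut_vertices S"
    and ne: "\<And>i. Suc i < n \<Longrightarrow> c (Suc i) \<noteq> c (Suc (Suc i))"
    and int: "\<And>i j. i < j \<Longrightarrow> j \<le> n \<Longrightarrow> verts (B i) \<inter> verts (B j) \<subseteq> (if j = Suc i then {c j} else {})"
    using seq unfolding block_sequence_def by blast+
  define c' where "c' = c(0 := v, Suc n := u)"
  have "prolongs (c' i) (B i) (c' (Suc i))" if i: "i \<le> n" for i
  proof (rule cycle_prolongs[OF _ t])
    show "is_cycle_graph t (B i)" using cyc im i by blast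
    show "c' i \<in> verts (B i)"
      using v cut[of "i - 1"] i by (cases i) (auto simp: c'_def)
    show "c' (Suc i) \<in> verts (B i)"
      using u cut[of i] i by (auto simp: c'_def)
    show "c' i \<noteq> c' (Suc i)"
    proof (cases i)
      case 0
      then show ?thesis using vu by (auto simp: c'_def)
    next
      case (Suc l)
      then show ?thesis using ne[of l] cut[of l] u(2) i by (auto simp: c'_def)
    qed
  qed
  moreover have "verts (B i) \<inter> verts (B j) \<subseteq> (if j = Suc i then {c' j} else {})"
    if "i < j" "j \<le> n" for i j
  proof -
    have "c' j = c j" using that by (simp add: c'_def)
    then show ?thesis using int[OF that] by (simp only:)
  qed
  ultimately have "prolongs (c' 0) \<lparr>verts = (\<Union>i\<le>n. verts (B i)), edges = (\<Union>i\<le>n. edges (B i))\<rparr> (c' (Suc n))"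
    by (rule chain_prolongs)
  moreover have "S = \<lparr>verts = (\<Union>C\<in>blocks S. verts C), edges = (\<Union>C\<in>blocks S. edges C)\<rparr>"
  proof (rule graph_eq_union_of_blocks[OF S _ _ vu(1)])
    have "verts C \<subseteq> verts S" if "C \<in> blocks S" for C using that by (simp add: blocks_def subgraph_def)
    then show "v \<in> verts S" "u \<in> verts S" using im u v by blast+
  qed
  then have "S = \<lparr>verts = (\<Union>i\<le>n. verts (B i)), edges = (\<Union>i\<le>n. edges (B i))\<rparr>"
    unfolding im[symmetric] by simp
  ultimately show ?thesis by (simp add: c'_def)
qed

lemma admissible_cycle_avoid:
  assumes "is_cycle_graph t C" "admissible t"
  shows "\<exists>x\<in>verts C. x \<noteq> a \<and> x \<noteq> b"
proof (rule ccontr)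
  assume "\<not> ?thesis"
  then have "verts C \<subseteq> {a, b}" by blast
  then have "card (verts C) \<le> card {a, b}" by (intro card_mono) simp_all
  also have "\<dots> \<le> 2" by (simp add: card_insert_if)
  finally show False using is_cycle_graph_card[OF assms(1)] assms(2) by (simp add: admissible_def)
qed

lemma cyclic_snake_prolongs:
  assumes S: "cyclic_snake k t S xs" and t: "admissible t"
    and F: "hd xs = Inl F" and L: "last xs = Inl L"
    and v: "v \<in> verts F" "v \<notin> cut_vertices S" and u: "u \<in> verts L" "u \<notin> cut_vertices S"
    and vu: "v \<noteq> u"
  shows "prolongs v S u"
proof -
  obtain n B c where seq: "block_sequence S n B c" "B n = L" "B 0 = F"
    using cyclic_snake_block_sequence[OF S L] F by metis
  have "v \<noteq> c 1" if "n > 0" using seq(1) v(2) that unfolding block_sequence_def by auto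
  then show ?thesis
    using block_sequence_prolongs[OF _ _ seq(1) _ t, of v u] S seq v u vu by (simp add: cyclic_snake_def)
qed

text \<open>
  The first part of a variable snake may start anywhere in its first block, so the starting vertex
  is chosen away from \<open>u\<close> and from the vertex shared with the second block.
\<close>

lemma cyclic_snake_prolongs_to:
  assumes S: "cyclic_snake k t S xs" and t: "admissible t" and L: "last xs = Inl L"
    and u: "u \<in> verts L" "u \<notin> cut_vertices S"
  shows "\<exists>v. prolongs v S u"
proof -
  obtain n B c where seq: "block_sequence S n B c" "B n = L"
    using cyclic_snake_block_sequence[OF S L] by metis
  have cyc: "\<forall>C\<in>blocks S. is_cycle_graph t C" using S by (simp add: cyclic_snake_def)
  have "B 0 \<in> blocks S" using seq(1) unfolding block_sequence_def by blast
  then obtain v where "v \<in> verts (B 0)" "v \<noteq> u" "v \<noteq> c 1"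
    using admissible_cycle_avoid[of t "B 0" u "c 1"] cyc t by blast
  then show ?thesis
    using block_sequence_prolongs[OF _ _ seq(1) cyc t, of v u] S seq u by (auto simp: cyclic_snake_def)
qed

lemma cyclic_snake_free_vertex:
  assumes S: "cyclic_snake k t S xs" and t: "admissible t" and L: "last xs = Inl L"
  shows "\<exists>u\<in>verts L. u \<notin> cut_vertices S \<and> u \<noteq> v"
proof -
  obtain n B c z where seq: "block_sequence S n B c" "B n = L" and z: "cut_vertices S \<inter> verts L \<subseteq> {z}"
    using cyclic_snake_block_sequence[OF S L] by metis
  then have "is_cycle_graph t L" using S by (auto simp: block_sequence_def cyclic_snake_def)
  then show ?thesis using admissible_cycle_avoid[of t L z v] t z by blast
qed

section \<open>Variable snakes\<close>

lemma graph_connected_union: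
  assumes G: "graph_connected G" and S: "graph_connected S" and v: "v \<in> verts G" "v \<in> verts S"
  shows "graph_connected (graph_union G S)"
proof -
  let ?R = "(adj (graph_union G S))\<^sup>*"
  have sub: "(adj G)\<^sup>* \<subseteq> ?R" "(adj S)\<^sup>* \<subseteq> ?R"
    by (auto intro!: rtrancl_mono adj_mono)
  have "(x, v) \<in> ?R" if "x \<in> verts G \<union> verts S" for x
  proof -
    have "(x, v) \<in> (adj G)\<^sup>* \<or> (x, v) \<in> (adj S)\<^sup>*"
      using that G S v unfolding graph_connected_def by blast
    then show ?thesis using sub by blast
  qed
  then show ?thesis using v unfolding graph_connected_def graph_union_simps
    by (blast intro: reach_sym rtrancl_trans)
qed

lemma identified_vertex_is_cut_vertex:
  assumes G: "simple_graph G" "graph_connected G" and S: "simple_graph S" "graph_connected S"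
    and v: "verts G \<inter> verts S = {v}" and a: "a \<in> verts G" "a \<noteq> v" and b: "b \<in> verts S" "b \<noteq> v"
  shows "v \<in> cut_vertices (graph_union G S)"
proof -
  let ?U = "graph_union G S"
  have "x \<in> verts G - {v}" if "(a, x) \<in> (adj (delete_vertex ?U v))\<^sup>*" for x
    using that
  proof (induction rule: rtrancl_induct)
    case (step x y)
    then have "(x, y) \<in> adj G \<or> (x, y) \<in> adj S" "x \<noteq> v" "y \<noteq> v"
      by (auto simp: adj_delete_iff) (auto simp: adj_def)
    then show ?case using step.IH v adj_verts[OF G(1)] adj_verts[OF S(1)] by blast
  qed (use a in simp)
  then have "(a, b) \<notin> (adj (delete_vertex ?U v))\<^sup>*" using b v by blast
  moreover have "(a, b) \<in> (adj ?U)\<^sup>*"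
    using graph_connected_union[OF G(2) S(2), of v] v a b by (auto simp: graph_connected_def)
  ultimately show ?thesis using a b v by (auto simp: cut_vertices_def)
qed

text \<open>
  A walk in the union that makes a detour through \<open>G\<close> leaves and re-enters \<open>S\<close> at \<open>v\<close>.  Collapsing \<open>G\<close> to \<open>v\<close>
  therefore turns walks of the union that avoid \<open>c\<close> into such walks of \<open>S\<close>.
\<close>

lemma cut_vertex_of_union:
  assumes G: "simple_graph G" and S: "simple_graph S"
    and v: "verts G \<inter> verts S = {v}" and c: "c \<in> cut_vertices S" "c \<noteq> v"
  shows "c \<in> cut_vertices (graph_union G S)"
proof -
  let ?U = "graph_union G S"
  define pr where "pr x = (if x \<in> verts S then x else v)" for x
  obtain a b where ab: "c \<in> verts S" "a \<in> verts S - {c}" "b \<in> verts S - {c}" "(a, b) \<in> (adj S)\<^sup>*"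
    "(a, b) \<notin> (adj (delete_vertex S c))\<^sup>*"
    using c by (auto simp: cut_vertices_def)
  have "(pr a, pr x) \<in> (adj (delete_vertex S c))\<^sup>*" if "(a, x) \<in> (adj (delete_vertex ?U c))\<^sup>*" for x
    using that
  proof (induction rule: rtrancl_induct)
    case (step x y)
    have "(x, y) \<in> adj G \<or> (x, y) \<in> adj S" and xy: "x \<noteq> c" "y \<noteq> c"
      using step.hyps(2) by (auto simp: adj_delete_iff) (auto simp: adj_def)
    then consider "(x, y) \<in> adj G" | "(x, y) \<in> adj S" by blast
    then show ?case
    proof cases
      case 1
      then have "x \<in> verts G" "y \<in> verts G" using adj_verts[OF G] by blast+
      then have "pr x = v" "pr y = v" using v by (auto simp: pr_def)
      then show ?thesis using step.IH by simp
    next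
      case 2
      then have "x \<in> verts S" "y \<in> verts S" using adj_verts[OF S] by blast+
      moreover have "(x, y) \<in> adj (delete_vertex S c)" using 2 xy by (simp add: adj_delete_iff)
      ultimately show ?thesis using step.IH by (simp add: pr_def)
    qed
  qed simp
  from this[of b] have "(a, b) \<notin> (adj (delete_vertex ?U c))\<^sup>*" using ab by (auto simp: pr_def)
  moreover have "(a, b) \<in> (adj ?U)\<^sup>*"
    using ab(4) rtrancl_mono[OF adj_mono[of S ?U]] by auto
  ultimately show ?thesis using ab by (auto simp: cut_vertices_def)
qed

text \<open>
  The condition on \<open>u\<close> is the one under which the next cyclic snake may be attached there: not being a
  cut vertex, \<open>u\<close> differs from the vertex at which the last cycle was entered.  The existence of some
  suitable \<open>u\<close> is part of the induction because the labelling has to start at such a vertex.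
\<close>

lemma variable_snake_prolongs:
  assumes "variable_snake_with_last ps G L" "\<And>k t. (k, t) \<in> set ps \<Longrightarrow> admissible t"
  shows "simple_graph G \<and> graph_connected G \<and>
    (\<forall>u\<in>verts L. u \<notin> cut_vertices G \<longrightarrow> (\<exists>v. prolongs v G u)) \<and>
    (\<exists>u\<in>verts L. \<exists>v. prolongs v G u)"
  using assms
proof (induction rule: variable_snake_with_last.induct)
  case (single k t S xs L)
  have t: "admissible t" using single.prems by simp
  have "\<exists>v. prolongs v S u" if "u \<in> verts L" "u \<notin> cut_vertices S" for u
    by (rule cyclic_snake_prolongs_to[OF single.hyps(1) t single.hyps(2) that])
  moreover have "\<exists>u\<in>verts L. u \<notin> cut_vertices S"
    using cyclic_snake_free_vertex[OF single.hyps(1) t single.hyps(2)] by blast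
  ultimately show ?case using single.hyps(1) unfolding cyclic_snake_def by blast
next
  case (attach ps G L k t S xs F L' v)
  have t: "admissible t" using attach.prems[of k t] by simp
  have G: "simple_graph G" "graph_connected G"
    and toL: "\<And>u. u \<in> verts L \<Longrightarrow> u \<notin> cut_vertices G \<Longrightarrow> \<exists>v. prolongs v G u"
    using attach.IH attach.prems by auto
  have S: "simple_graph S" "graph_connected S" using attach.hyps(2) by (auto simp: cyclic_snake_def)
  obtain w where w: "prolongs w G v" using toL attach.hyps by blast
  have ext: "\<exists>w. prolongs w (graph_union G S) u"
    if "u \<in> verts L'" "u \<notin> cut_vertices S" "u \<noteq> v" for u
  proof -
    have "prolongs v S u"
      by (rule cyclic_snake_prolongs[OF attach.hyps(2) t attach.hyps(3,4)])
        (use attach.hyps that in auto)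
    then show ?thesis using prolongs_trans[OF w _ attach.hyps(5)] by blast
  qed
  obtain u0 where u0: "u0 \<in> verts L'" "u0 \<notin> cut_vertices S" "u0 \<noteq> v"
    using cyclic_snake_free_vertex[OF attach.hyps(2) t attach.hyps(4)] by blast
  have u0S: "prolongs v S u0"
    by (rule cyclic_snake_prolongs[OF attach.hyps(2) t attach.hyps(3,4)])
      (use attach.hyps u0 in auto)
  have vcut: "v \<in> cut_vertices (graph_union G S)"
    using identified_vertex_is_cut_vertex[OF G S attach.hyps(5), of w u0] w u0S
    by (auto simp: prolongs_def)
  have "\<exists>w. prolongs w (graph_union G S) u"
    if u: "u \<in> verts L'" "u \<notin> cut_vertices (graph_union G S)" for u
  proof (rule ext[OF u(1)])
    show "u \<noteq> v" using vcut u by blast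
    then show "u \<notin> cut_vertices S" using cut_vertex_of_union[OF G(1) S(1) attach.hyps(5)] u by blast
  qed
  moreover have "graph_connected (graph_union G S)"
    using graph_connected_union[OF G(2) S(2)] attach.hyps(5) by blast
  ultimately show ?case using simple_graph_union[OF G(1) S(1)] ext[OF u0] u0 by blast
qed

text \<open>
  The backwards construction starts from the graph with the single vertex \<open>u\<close>.
\<close>

lemma graceful_if_prolongs:
  assumes "prolongs v G u"
  shows "graceful G"
proof -
  let ?H = "\<lparr>verts = {u}, edges = {}\<rparr>"
  have u: "u \<in> verts G" using assms by (simp add: prolongs_def)
  have "graceful_labelling ?H (\<lambda>_. 0)"
    by (simp add: graceful_labelling_def bij_betw_def)
  then have "graceful_from ?H u" by (auto simp: graceful_from_def)
  moreover have "simple_graph ?H" by (simp add: simple_graph_def)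
  ultimately have "graceful_from (graph_union G ?H) v" using assms u by (simp add: prolongs_def)
  moreover have "graph_union G ?H = G" using u by (simp add: graph_union_def insert_absorb)
  ultimately show ?thesis by (auto simp: graceful_from_def graceful_def)
qed

theorem corollary2p4:
  fixes n j :: nat and m k :: "nat \<Rightarrow> nat" and G :: "'a ugraph"
  assumes "n \<ge> 1"
    and "\<forall>i\<in>{1..n}. \<forall>s\<ge>1.
           \<exists>U :: (nat ugraph \<times> (nat \<Rightarrow> int)) set. complete_useful_cycle_set s (4 * i) U"
    and "j \<ge> 1"
    and "\<forall>l\<in>{1..j}. 1 \<le> m l \<and> m l \<le> n"
    and "\<forall>l\<in>{1..j}. k l \<ge> 1"
    and "variable_snake (map (\<lambda>l. (k l, 4 * m l)) [1..<Suc j]) G"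
  shows "graceful G"
proof -
  obtain L where L: "variable_snake_with_last (map (\<lambda>l. (k l, 4 * m l)) [1..<Suc j]) G L"
    using assms(6) by (auto simp: variable_snake_def)
  have "admissible t" if "(k', t) \<in> set (map (\<lambda>l. (k l, 4 * m l)) [1..<Suc j])" for k' t
  proof -
    from that have "t \<in> (\<lambda>l. 4 * m l) ` {1..j}" by force
    then obtain l where l: "l \<in> {1..j}" "t = 4 * m l" by blast
    then have "1 \<le> m l" "m l \<in> {1..n}" using assms(4) by auto
    moreover have "\<exists>U :: (nat ugraph \<times> (nat \<Rightarrow> int)) set. complete_useful_cycle_set 2 (4 * m l) U"
      using assms(2) \<open>m l \<in> {1..n}\<close> by simp
    ultimately show ?thesis using l(2) by (simp add: admissible_def)
  qed
  then obtain u v where "prolongs v G u" using variable_snake_prolongs[OF L] by blast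
  then show ?thesis by (rule graceful_if_prolongs)
qed

end
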